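(* Let $a \in \mathbb{R}^n$, let $P \in \mathbb{R}^{n \times n}$ be a (symmetric) positive definite matrix, let $c \in \mathbb{R}^n$, and let $r \in \mathbb{R}$ with $r > 0$. Then the solution $v^*$ of the convex optimization problem $$\min_{v \in \mathbb{R}^n} \; \left\{ \tfrac{1}{2} \| v - a \|_P^2 \; : \; v \in \mathcal{E}(P, c, r) \right\}$$ is given by $$v^* = \begin{cases} a & \text{if } a \in \mathcal{E}(P, c, r), \\[0.5em] \dfrac{r (a - c)}{\sqrt{(a - c)^\top P (a - c)}} + c & \text{otherwise.} \end{cases}$$
   Context: For $x \in \mathbb{R}^n$ and a positive definite matrix $P \in \mathbb{R}^{n \times n}$, $\|x\|_P := \sqrt{x^\top P x}$. For a positive definite $P \in \mathbb{R}^{n\times n}$, $c \in \mathbb{R}^n$ and real $r > 0$, the ellipsoid $\mathcal{E}(P, c, r)$ is the set $\{ x \in \mathbb{R}^n : (x - c)^\top P (x - c) \leq r^2 \}$. Positive definite matrices are understood to be symmetric. *)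

theory Defs
  imports "HOL-Analysis.Analysis"
begin

definition positive_definite :: "real ^ 'n ^ 'n \<Rightarrow> bool" where
  "positive_definite P \<longleftrightarrow> transpose P = P \<and> (\<forall>x. x \<noteq> 0 \<longrightarrow> x \<bullet> (P *v x) > 0)"

definition weighted_norm :: "real ^ 'n ^ 'n \<Rightarrow> real ^ 'n \<Rightarrow> real" where
  "weighted_norm P x = sqrt (x \<bullet> (P *v x))"

definition ellipsoid :: "real ^ 'n ^ 'n \<Rightarrow> real ^ 'n \<Rightarrow> real \<Rightarrow> (real ^ 'n) set" where
  "ellipsoid P c r = {x. (x - c) \<bullet> (P *v (x - c)) \<le> r\<^sup>2}"

end

theory Submission
  imports Defs
begin

text \<open>
  Write \<open>q x = x \<bullet> (P *v x)\<close> and translate the centre \<open>c\<close> to the origin, so that \<open>d = a - c\<close> is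
  projected onto the ball \<open>q w \<le> r\<^sup>2\<close>. If \<open>d\<close> lies in the ball, it has distance zero to itself
  and positive distance to every other point. Otherwise \<open>s = sqrt (q d)\<close> exceeds \<open>r\<close>, and the
  candidate is the radial point \<open>(r / s) d\<close>. Eliminating the mixed term \<open>w \<bullet> (P *v d)\<close> between the
  expansions of \<open>q (w - d)\<close> and \<open>q (w - (r / s) d)\<close> gives
  \<open>r q (w - d) = s q (w - (r / s) d) + r (s - r)\<^sup>2 + (s - r) (r\<^sup>2 - q w)\<close>.
  For feasible \<open>w\<close> the last term is nonnegative, so \<open>q (w - d)\<close> is at least \<open>(s - r)\<^sup>2\<close>, the value
  at the candidate, and exceeds it by at least \<open>(s / r) q (w - (r / s) d)\<close>, which is positive
  away from the candidate. This yields optimality and uniqueness together, without the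
  Cauchy-Schwarz inequality and without compactness or convexity arguments.
\<close>

lemma is_arg_min_iff_eq_strict_minimizer:
  fixes f :: "'a \<Rightarrow> 'b::order"
  assumes "Q m" and "\<And>x. Q x \<Longrightarrow> x \<noteq> m \<Longrightarrow> f m < f x"
  shows "is_arg_min f Q x \<longleftrightarrow> x = m"
  using assms by (metis is_arg_min_def less_irrefl less_asym)

lemma quadratic_form_pos:
  assumes "positive_definite P" and "x \<noteq> 0"
  shows "x \<bullet> (P *v x) > 0"
  using assms by (simp add: positive_definite_def)

lemma quadratic_form_nonneg:
  assumes "positive_definite P"
  shows "x \<bullet> (P *v x) \<ge> 0"
  using quadratic_form_pos[OF assms, of x] by (cases "x = 0") auto

lemma weighted_norm_power2:
  assumes "positive_definite P"
  shows "(weighted_norm P x)\<^sup>2 = x \<bullet> (P *v x)"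
  using quadratic_form_nonneg[OF assms] by (simp add: weighted_norm_def)

lemma bilinear_form_commute:
  fixes P :: "real ^ 'n ^ 'n"
  assumes "transpose P = P"
  shows "x \<bullet> (P *v y) = y \<bullet> (P *v x)"
  by (metis assms dot_lmul_matrix inner_commute transpose_matrix_vector)

lemma quadratic_form_scaleR:
  fixes P :: "real ^ 'n ^ 'n"
  shows "(t *\<^sub>R x) \<bullet> (P *v (t *\<^sub>R x)) = t\<^sup>2 * (x \<bullet> (P *v x))"
  by (simp add: matrix_vector_mult_scaleR power2_eq_square)

lemma quadratic_form_diff_scaleR:
  fixes P :: "real ^ 'n ^ 'n"
  assumes "transpose P = P"
  shows "(w - t *\<^sub>R d) \<bullet> (P *v (w - t *\<^sub>R d)) =
    w \<bullet> (P *v w) - 2 * t * (w \<bullet> (P *v d)) + t\<^sup>2 * (d \<bullet> (P *v d))"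
  using bilinear_form_commute[OF assms, of d w]
  by (simp add: matrix_vector_mult_diff_distrib matrix_vector_mult_scaleR
      inner_diff_left inner_diff_right power2_eq_square algebra_simps)

text \<open>
  The coefficients are those that cancel the mixed term: the second expansion carries it with
  the factor \<open>r / s\<close> relative to the first, so the two sides are weighted by \<open>r\<close> and \<open>s\<close>.
\<close>
lemma radial_projection_identity:
  fixes P :: "real ^ 'n ^ 'n"
  assumes "transpose P = P" and "d \<bullet> (P *v d) = s\<^sup>2" and "s \<noteq> 0"
  shows "r * ((w - d) \<bullet> (P *v (w - d))) =
    s * ((w - (r / s) *\<^sub>R d) \<bullet> (P *v (w - (r / s) *\<^sub>R d)))
      + r * (s - r)\<^sup>2 + (s - r) * (r\<^sup>2 - w \<bullet> (P *v w))"
proof -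
  have full: "(w - d) \<bullet> (P *v (w - d)) = w \<bullet> (P *v w) - 2 * (w \<bullet> (P *v d)) + s\<^sup>2"
    using quadratic_form_diff_scaleR[OF assms(1), of w 1 d] assms(2) by simp
  have radial: "s * ((w - (r / s) *\<^sub>R d) \<bullet> (P *v (w - (r / s) *\<^sub>R d))) =
      s * (w \<bullet> (P *v w)) - 2 * r * (w \<bullet> (P *v d)) + s * r\<^sup>2"
    unfolding quadratic_form_diff_scaleR[OF assms(1)] assms(2)
    using assms(3) by (simp add: field_simps power2_eq_square)
  show ?thesis
    unfolding full radial by (simp add: algebra_simps power2_eq_square)
qed

lemma radial_projection_strict_minimizer:
  fixes P :: "real ^ 'n ^ 'n"
  assumes P: "positive_definite P" and "r > 0"
    and s: "d \<bullet> (P *v d) = s\<^sup>2" "r \<le> s"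
    and w: "w \<bullet> (P *v w) \<le> r\<^sup>2" "w \<noteq> (r / s) *\<^sub>R d"
  defines "m \<equiv> (r / s) *\<^sub>R d"
  shows "(m - d) \<bullet> (P *v (m - d)) < (w - d) \<bullet> (P *v (w - d))"
proof -
  have "s > 0" and sym: "transpose P = P"
    using assms by (auto simp: positive_definite_def)
  have "m - d = ((r - s) / s) *\<^sub>R d"
    using \<open>s > 0\<close> by (simp add: m_def diff_divide_distrib scaleR_diff_left)
  then have "(m - d) \<bullet> (P *v (m - d)) = (s - r)\<^sup>2"
    using \<open>s > 0\<close> unfolding \<open>m - d = _\<close> quadratic_form_scaleR s(1)
    by (simp add: power_divide power2_commute)
  moreover have "s * ((w - m) \<bullet> (P *v (w - m))) > 0"
    using quadratic_form_pos[OF P, of "w - m"] w(2) \<open>s > 0\<close> by (simp add: m_def)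
  moreover have "(s - r) * (r\<^sup>2 - w \<bullet> (P *v w)) \<ge> 0"
    using s(2) w(1) by simp
  ultimately have "r * ((m - d) \<bullet> (P *v (m - d))) < r * ((w - d) \<bullet> (P *v (w - d)))"
    using radial_projection_identity[OF sym s(1), of r w] \<open>s > 0\<close> by (simp add: m_def)
  then show ?thesis
    using \<open>r > 0\<close> by simp
qed

theorem proposition1:
  fixes a c v :: "real ^ 'n" and P :: "real ^ 'n ^ 'n" and r :: real
  assumes "positive_definite P" and "r > 0"
  shows "is_arg_min (\<lambda>v. (1 / 2) * (weighted_norm P (v - a))\<^sup>2) (\<lambda>v. v \<in> ellipsoid P c r) v
    \<longleftrightarrow> v = (if a \<in> ellipsoid P c r then a
             else (r / sqrt ((a - c) \<bullet> (P *v (a - c)))) *\<^sub>R (a - c) + c)"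
proof (cases "a \<in> ellipsoid P c r")
  case True
  have "is_arg_min (\<lambda>v. (1 / 2) * (weighted_norm P (v - a))\<^sup>2) (\<lambda>v. v \<in> ellipsoid P c r) v
      \<longleftrightarrow> v = a"
    using True quadratic_form_pos[OF assms(1)]
    by (intro is_arg_min_iff_eq_strict_minimizer) (simp_all add: weighted_norm_power2[OF assms(1)])
  with True show ?thesis by simp
next
  case False
  define d where "d = a - c"
  define s where "s = sqrt (d \<bullet> (P *v d))"
  define m where "m = (r / s) *\<^sub>R d + c"
  have s: "d \<bullet> (P *v d) = s\<^sup>2"
    using quadratic_form_nonneg[OF assms(1)] by (simp add: s_def)
  have "r < s"
    using False assms(2) unfolding s_def
    by (intro real_less_rsqrt) (simp add: ellipsoid_def d_def)
  have m_feasible: "m \<in> ellipsoid P c r"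
    using \<open>r < s\<close> assms(2) unfolding ellipsoid_def m_def mem_Collect_eq add_diff_cancel_right'
      quadratic_form_scaleR s by (simp add: power_divide)
  have "(1 / 2) * (weighted_norm P (m - a))\<^sup>2 < (1 / 2) * (weighted_norm P (x - a))\<^sup>2"
    if "x \<in> ellipsoid P c r" "x \<noteq> m" for x
  proof -
    have "(x - c) \<bullet> (P *v (x - c)) \<le> r\<^sup>2" "x - c \<noteq> (r / s) *\<^sub>R d"
      using that unfolding ellipsoid_def m_def mem_Collect_eq by (blast, metis diff_add_cancel)
    from radial_projection_strict_minimizer[OF assms s less_imp_le[OF \<open>r < s\<close>] this]
    have "((m - c) - d) \<bullet> (P *v ((m - c) - d)) < ((x - c) - d) \<bullet> (P *v ((x - c) - d))"
      by (simp add: m_def)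
    then show ?thesis
      by (simp add: weighted_norm_power2[OF assms(1)] d_def)
  qed
  with m_feasible have "is_arg_min (\<lambda>v. (1 / 2) * (weighted_norm P (v - a))\<^sup>2)
      (\<lambda>v. v \<in> ellipsoid P c r) v \<longleftrightarrow> v = m"
    by (rule is_arg_min_iff_eq_strict_minimizer)
  with False show ?thesis
    by (simp add: m_def s_def d_def)
qed

end
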